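(* Let $\mathcal J$ be an $l\times l$ block Jacobi matrix of type $1$ satisfying $\sum_{n=1}^\infty\bigl[\|B_n\|+\|\mathbf 1-A_nA_n^*\|\bigr]<\infty$. Then uniformly on compact subsets of the open unit disk $\mathbb D$ the limit $$\lim_{n\to\infty}z^n\,\mathfrak p_n^L(z+z^{-1})$$ exists and is equal to $\dfrac{1}{1-z^2}\,g_\infty(z)$.
   Context: A block Jacobi matrix $\mathcal J$ has parameters $\{A_n,B_n\}_{n\ge1}$, with $A_n$ invertible and $B_n$ Hermitian $l\times l$ matrices; it is the semi-infinite block tridiagonal matrix with diagonal blocks $B_n$, superdiagonal blocks $A_n$ and subdiagonal blocks $A_n^*$. It is of type $1$ if $A_n>0$ for all $n$. $\mathbf 1,\mathbf 0$ are the $l\times l$ identity and zero matrices. The left orthonormal polynomials $\mathfrak p^L_n$ of $\mathcal J$ are defined by $\mathfrak p^L_{-1}=\mathbf 0$, $\mathfrak p^L_0=\mathbf 1$, $A_0=\mathbf 1$ and $$x\,\mathfrak p_n^L(x)=A_{n+1}\mathfrak p_{n+1}^L(x)+B_{n+1}\mathfrak p_n^L(x)+A_n^*\mathfrak p_{n-1}^L(x),\quad n\ge0.$$ (So $c_n(z)=z^n\mathfrak p_n^L(z+z^{-1})$ is a matrix polynomial in $z$.) Put $g_n(z)=z^n\bigl(\mathfrak p_n^L(z+z^{-1})-zA_n^*\mathfrak p_{n-1}^L(z+z^{-1})\bigr)$; equivalently $g_0=c_0=\mathbf 1$, $A_{n+1}c_{n+1}=(z^2\mathbf 1-zB_{n+1})c_n+g_n$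 and $A_{n+1}g_{n+1}=\bigl(z^2(\mathbf 1-A_{n+1}A_{n+1}^* )-zB_{n+1}\bigr)c_n+g_n$. Under the hypotheses of the theorem the limit $g_\infty(z)=\lim_{n\to\infty}g_n(z)$ exists uniformly on compact subsets of $\overline{\mathbb D}\setminus\{\pm1\}$, is continuous there and analytic in $\mathbb D$. *)

theory Defs
  imports "HOL-Analysis.Analysis"
begin

definition adj :: "complex ^ 'n ^ 'm \<Rightarrow> complex ^ 'm ^ 'n"
  where "adj M = map_matrix cnj (transpose M)"

definition hermitian :: "complex ^ 'n ^ 'n \<Rightarrow> bool"
  where "hermitian M \<longleftrightarrow> adj M = M"

definition pos_def :: "complex ^ 'n::finite ^ 'n \<Rightarrow> bool"
  where "pos_def M \<longleftrightarrow>
    hermitian M \<and> (\<forall>v. v \<noteq> 0 \<longrightarrow> 0 < Re (\<Sum>i\<in>UNIV. cnj (v $ i) * (M *v v) $ i))"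

definition opnorm :: "complex ^ 'n::finite ^ 'm::finite \<Rightarrow> real"
  where "opnorm M = onorm ((*v) M)"

definition cscale :: "complex \<Rightarrow> complex ^ 'n ^ 'm \<Rightarrow> complex ^ 'n ^ 'm"  (infixr "*\<^sub>c" 75)
  where "z *\<^sub>c M = (\<chi> i j. z * M $ i $ j)"

text \<open>
  A block Jacobi matrix (diagonal blocks \<open>B n\<close>, superdiagonal blocks \<open>A n\<close>, subdiagonal blocks
  \<open>adj (A n)\<close>) is given by its parameters; only \<open>A n\<close>, \<open>B n\<close> with \<open>n \<ge> 1\<close> matter. The
  convention that the block with index \<open>0\<close> is the identity is implemented by \<open>A0\<close>.
\<close>

definition block_jacobi :: "(nat \<Rightarrow> complex ^ 'l::finite ^ 'l) \<Rightarrow> (nat \<Rightarrow> complex ^ 'l ^ 'l) \<Rightarrow> bool"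
  where "block_jacobi A B \<longleftrightarrow> (\<forall>n\<ge>1. invertible (A n) \<and> hermitian (B n))"

definition type1 :: "(nat \<Rightarrow> complex ^ 'l::finite ^ 'l) \<Rightarrow> bool"
  where "type1 A \<longleftrightarrow> (\<forall>n\<ge>1. pos_def (A n))"

definition A0 :: "(nat \<Rightarrow> complex ^ 'l::finite ^ 'l) \<Rightarrow> nat \<Rightarrow> complex ^ 'l ^ 'l"
  where "A0 A n = (if n = 0 then mat 1 else A n)"

text \<open>
  \<open>pL_shift A B k\<close> is the left orthonormal polynomial of index \<open>k - 1\<close>, so that the
  recursion can start at index \<open>-1\<close>.
\<close>

fun pL_shift :: "(nat \<Rightarrow> complex ^ 'l::finite ^ 'l) \<Rightarrow> (nat \<Rightarrow> complex ^ 'l ^ 'l)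
    \<Rightarrow> nat \<Rightarrow> complex \<Rightarrow> complex ^ 'l ^ 'l"
  where
    "pL_shift A B 0 x = 0"
  | "pL_shift A B (Suc 0) x = mat 1"
  | "pL_shift A B (Suc (Suc n)) x =
       matrix_inv (A (n + 1)) **
         (x *\<^sub>c pL_shift A B (Suc n) x - B (n + 1) ** pL_shift A B (Suc n) x
            - adj (A0 A n) ** pL_shift A B n x)"

definition pL :: "(nat \<Rightarrow> complex ^ 'l::finite ^ 'l) \<Rightarrow> (nat \<Rightarrow> complex ^ 'l ^ 'l)
    \<Rightarrow> int \<Rightarrow> complex \<Rightarrow> complex ^ 'l ^ 'l"
  where "pL A B n = pL_shift A B (nat (n + 1))"

lemma cscale_mult_right: "X ** (z *\<^sub>c Y) = z *\<^sub>c (X ** Y)"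
  by (simp add: cscale_def matrix_matrix_mult_def vec_eq_iff sum_distrib_left ac_simps)

lemma cscale_mult_left: "(z *\<^sub>c X) ** Y = z *\<^sub>c (X ** Y)"
  by (simp add: cscale_def matrix_matrix_mult_def vec_eq_iff sum_distrib_left ac_simps)

lemma cscale_cscale: "z *\<^sub>c w *\<^sub>c X = (z * w) *\<^sub>c X"
  by (simp add: cscale_def vec_eq_iff ac_simps)

lemma cscale_diff: "z *\<^sub>c (X - Y) = z *\<^sub>c X - z *\<^sub>c Y"
  by (simp add: cscale_def vec_eq_iff algebra_simps)

lemma matrix_diff_ldistrib: "X ** (Y - Z) = X ** Y - X ** Z"
  for X :: "complex ^ 'n::finite ^ 'm"
  by (simp add: matrix_matrix_mult_def vec_eq_iff algebra_simps sum_subtractf)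

lemma matrix_diff_rdistrib: "(Y - Z) ** X = Y ** X - Z ** X"
  for X :: "complex ^ 'n ^ 'm::finite"
  by (simp add: matrix_matrix_mult_def vec_eq_iff algebra_simps sum_subtractf)

lemma matrix_inv_cancel:
  fixes M :: "complex ^ 'l::finite ^ 'l"
  assumes "invertible M"
  shows "M ** (matrix_inv M ** X) = X" "matrix_inv M ** (M ** X) = X"
proof -
  have "M ** matrix_inv M = mat 1 \<and> matrix_inv M ** M = mat 1"
    using assms unfolding invertible_def matrix_inv_def by (rule someI_ex)
  then show "M ** (matrix_inv M ** X) = X" "matrix_inv M ** (M ** X) = X"
    by (simp_all add: matrix_mul_assoc)
qed

lemma continuous_on_matrix_mult:
  fixes f :: "complex \<Rightarrow> complex ^ 'n::finite ^ 'm::finite" and h :: "complex \<Rightarrow> complex ^ 'k::finite ^ 'n"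
  assumes "continuous_on S f" "continuous_on S h"
  shows "continuous_on S (\<lambda>z. f z ** h z)"
  unfolding matrix_matrix_mult_def by (intro continuous_intros assms)

lemma continuous_on_cscale:
  fixes f :: "complex \<Rightarrow> complex ^ 'n::finite ^ 'm::finite"
  assumes "continuous_on S u" "continuous_on S f"
  shows "continuous_on S (\<lambda>z. u z *\<^sub>c f z)"
  unfolding cscale_def by (intro continuous_intros assms)

lemma pL_recurrence:
  assumes "block_jacobi A B"
  shows "pL A B (- 1) x = 0" "pL A B 0 x = mat 1"
    "x *\<^sub>c pL A B (int n) x =
       A (n + 1) ** pL A B (int n + 1) x + B (n + 1) ** pL A B (int n) x
         + adj (A0 A n) ** pL A B (int n - 1) x"
proof -
  have *: "nat (int n + 1) = Suc n" "nat (2 + int n) = Suc (Suc n)"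
    by auto
  show "pL A B (- 1) x = 0" "pL A B 0 x = mat 1"
    by (auto simp: pL_def)
  show "x *\<^sub>c pL A B (int n) x =
       A (n + 1) ** pL A B (int n + 1) x + B (n + 1) ** pL A B (int n) x
         + adj (A0 A n) ** pL A B (int n - 1) x"
    using assms by (simp add: pL_def * matrix_inv_cancel block_jacobi_def)
qed

text \<open>
  \<open>c_poly\<close> and \<open>g_poly\<close> below are matrix polynomials in \<open>z\<close>, but the formulas defining them involve
  \<open>1 / z\<close>. Their value at the removable singularity \<open>z = 0\<close> is the limit there; the
  recursions \<open>c_poly_Suc\<close>, \<open>g_poly_Suc\<close> hold for all \<open>z\<close>.
\<close>

definition extend_at_0 :: "(complex \<Rightarrow> 'a::t2_space) \<Rightarrow> complex \<Rightarrow> 'a"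
  where "extend_at_0 f z = (if z = 0 then Lim (at 0) f else f z)"

definition c_poly :: "(nat \<Rightarrow> complex ^ 'l::finite ^ 'l) \<Rightarrow> (nat \<Rightarrow> complex ^ 'l ^ 'l)
    \<Rightarrow> nat \<Rightarrow> complex \<Rightarrow> complex ^ 'l ^ 'l"
  where "c_poly A B n = extend_at_0 (\<lambda>z. z ^ n *\<^sub>c pL A B (int n) (z + 1 / z))"

definition g_poly :: "(nat \<Rightarrow> complex ^ 'l::finite ^ 'l) \<Rightarrow> (nat \<Rightarrow> complex ^ 'l ^ 'l)
    \<Rightarrow> nat \<Rightarrow> complex \<Rightarrow> complex ^ 'l ^ 'l"
  where "g_poly A B n = extend_at_0 (\<lambda>z. z ^ n *\<^sub>c
    (pL A B (int n) (z + 1 / z) - z *\<^sub>c (adj (A0 A n) ** pL A B (int n - 1) (z + 1 / z))))"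

context
  fixes A B :: "nat \<Rightarrow> complex ^ 'l::finite ^ 'l"
  assumes J: "block_jacobi A B"
begin

private fun cg :: "nat \<Rightarrow> complex \<Rightarrow> (complex ^ 'l ^ 'l) \<times> (complex ^ 'l ^ 'l)"
  where
    "cg 0 z = (mat 1, mat 1)"
  | "cg (Suc n) z =
      (matrix_inv (A (n + 1)) **
         ((z\<^sup>2 *\<^sub>c mat 1 - z *\<^sub>c B (n + 1)) ** fst (cg n z) + snd (cg n z)),
       matrix_inv (A (n + 1)) **
         ((z\<^sup>2 *\<^sub>c (mat 1 - A (n + 1) ** adj (A (n + 1))) - z *\<^sub>c B (n + 1)) ** fst (cg n z)
            + snd (cg n z)))"

private lemma continuous_cg:
  "continuous_on UNIV (\<lambda>z. fst (cg n z))" "continuous_on UNIV (\<lambda>z. snd (cg n z))"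
proof (induction n)
  case (Suc n)
  {
    case 1
    show ?case
      using Suc by (auto intro!: continuous_intros continuous_on_matrix_mult continuous_on_cscale)
  next
    case 2
    show ?case
      using Suc by (auto intro!: continuous_intros continuous_on_matrix_mult continuous_on_cscale)
  }
qed auto

private lemma cg_eq:
  assumes "z \<noteq> 0"
  shows "z ^ n *\<^sub>c pL A B (int n) (z + 1 / z) = fst (cg n z) \<and>
    z ^ n *\<^sub>c (pL A B (int n) (z + 1 / z)
       - z *\<^sub>c (adj (A0 A n) ** pL A B (int n - 1) (z + 1 / z))) = snd (cg n z)"
proof (induction n)
  case 0
  show ?case
    by (simp add: pL_def cscale_def vec_eq_iff)
next
  case (Suc n)
  define a where "a = A (n + 1)"
  define b where "b = B (n + 1)"
  define p where "p = pL A B (int n) (z + 1 / z)"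
  define q where "q = pL A B (int n + 1) (z + 1 / z)"
  define r where "r = adj (A0 A n) ** pL A B (int n - 1) (z + 1 / z)"
  have inv: "invertible a"
    using J by (simp add: block_jacobi_def a_def)
  have A0: "A0 A (Suc n) = a"
    by (simp add: A0_def a_def)
  have aq: "a ** q = (z + 1 / z) *\<^sub>c p - b ** p - r"
    using pL_recurrence(3)[OF J, of "z + 1 / z" n]
    by (simp add: a_def b_def p_def q_def r_def algebra_simps)
  note cancel = matrix_inv_cancel(2)[OF inv]
  have IH: "fst (cg n z) = z ^ n *\<^sub>c p" "snd (cg n z) = z ^ n *\<^sub>c (p - z *\<^sub>c r)"
    using Suc by (simp_all add: p_def r_def)
  have c: "a ** (z ^ Suc n *\<^sub>c q)
      = (z\<^sup>2 *\<^sub>c mat 1 - z *\<^sub>c b) ** (z ^ n *\<^sub>c p) + z ^ n *\<^sub>c (p - z *\<^sub>c r)"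
  proof -
    have "a ** (z ^ Suc n *\<^sub>c q) = z ^ Suc n *\<^sub>c (a ** q)"
      by (simp add: cscale_mult_right)
    also have "\<dots> = z ^ Suc n *\<^sub>c ((z + 1 / z) *\<^sub>c p - b ** p - r)"
      by (simp add: aq)
    also have "\<dots> = (z\<^sup>2 * z ^ n) *\<^sub>c p - (z * z ^ n) *\<^sub>c (b ** p) + z ^ n *\<^sub>c (p - z *\<^sub>c r)"
      using assms by (simp add: cscale_def vec_eq_iff field_simps power2_eq_square)
    also have "\<dots> = (z\<^sup>2 *\<^sub>c mat 1 - z *\<^sub>c b) ** (z ^ n *\<^sub>c p) + z ^ n *\<^sub>c (p - z *\<^sub>c r)"
      by (simp add: matrix_diff_rdistrib cscale_mult_right cscale_mult_left cscale_cscale cscale_diff ac_simps)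
    finally show ?thesis .
  qed
  have g: "a ** (z ^ Suc n *\<^sub>c (q - z *\<^sub>c (adj a ** p)))
      = (z\<^sup>2 *\<^sub>c (mat 1 - a ** adj a) - z *\<^sub>c b) ** (z ^ n *\<^sub>c p) + z ^ n *\<^sub>c (p - z *\<^sub>c r)"
  proof -
    have "a ** (z ^ Suc n *\<^sub>c (q - z *\<^sub>c (adj a ** p)))
        = a ** (z ^ Suc n *\<^sub>c q) - (z\<^sup>2 * z ^ n) *\<^sub>c (a ** adj a ** p)"
      by (simp add: cscale_mult_right cscale_diff matrix_diff_ldistrib cscale_cscale
          matrix_mul_assoc power2_eq_square ac_simps)
    also have "\<dots> = (z\<^sup>2 * z ^ n) *\<^sub>c p - (z * z ^ n) *\<^sub>c (b ** p) + z ^ n *\<^sub>c (p - z *\<^sub>c r)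
        - (z\<^sup>2 * z ^ n) *\<^sub>c (a ** adj a ** p)"
      unfolding c
      by (simp add: matrix_diff_rdistrib cscale_mult_right cscale_mult_left cscale_cscale
          cscale_diff ac_simps)
    also have "\<dots> = (z\<^sup>2 *\<^sub>c (mat 1 - a ** adj a) - z *\<^sub>c b) ** (z ^ n *\<^sub>c p)
        + z ^ n *\<^sub>c (p - z *\<^sub>c r)"
      by (simp only: matrix_diff_rdistrib cscale_mult_right cscale_mult_left cscale_cscale
          cscale_diff matrix_mul_lid) (simp add: ac_simps)
    finally show ?thesis .
  qed
  have *: "int (Suc n) = int n + 1" "int n + 1 - 1 = int n"
    by simp_all
  show ?case
    unfolding * A0 cg.simps fst_conv snd_conv IH
    unfolding a_def[symmetric] b_def[symmetric] p_def[symmetric] q_def[symmetric]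
      c[symmetric] g[symmetric] cancel
    by simp
qed

private lemma extend_at_0_eq:
  fixes h :: "complex \<Rightarrow> 'a::t2_space"
  assumes "continuous_on UNIV h" and "\<And>z. z \<noteq> 0 \<Longrightarrow> f z = h z"
  shows "extend_at_0 f = h"
proof -
  have "(h \<longlongrightarrow> h 0) (at 0)"
    using assms(1) by (simp add: continuous_on_def)
  then have "(f \<longlongrightarrow> h 0) (at 0)"
    by (rule Lim_transform_eventually) (auto simp: eventually_at_filter assms(2))
  then have "Lim (at 0) f = h 0"
    by (intro tendsto_Lim) auto
  then show ?thesis
    by (auto simp: extend_at_0_def assms(2))
qed

private lemma c_poly_eq: "c_poly A B n = (\<lambda>z. fst (cg n z))"
  unfolding c_poly_def using cg_eq by (intro extend_at_0_eq continuous_cg) blast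

private lemma g_poly_eq: "g_poly A B n = (\<lambda>z. snd (cg n z))"
  unfolding g_poly_def using cg_eq by (intro extend_at_0_eq continuous_cg) blast

lemma c_poly_0: "c_poly A B 0 z = mat 1"
  and g_poly_0: "g_poly A B 0 z = mat 1"
  by (simp_all add: c_poly_eq g_poly_eq)

lemma c_poly_Suc:
  "A (n + 1) ** c_poly A B (n + 1) z =
    (z\<^sup>2 *\<^sub>c mat 1 - z *\<^sub>c B (n + 1)) ** c_poly A B n z + g_poly A B n z"
  using J by (simp add: c_poly_eq g_poly_eq block_jacobi_def matrix_inv_cancel)

lemma g_poly_Suc:
  "A (n + 1) ** g_poly A B (n + 1) z =
    (z\<^sup>2 *\<^sub>c (mat 1 - A (n + 1) ** adj (A (n + 1))) - z *\<^sub>c B (n + 1)) ** c_poly A B n z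
      + g_poly A B n z"
  using J by (simp add: c_poly_eq g_poly_eq block_jacobi_def matrix_inv_cancel)

end

definition g_inf :: "(nat \<Rightarrow> complex ^ 'l::finite ^ 'l) \<Rightarrow> (nat \<Rightarrow> complex ^ 'l ^ 'l)
    \<Rightarrow> complex \<Rightarrow> complex ^ 'l ^ 'l"
  where "g_inf A B z = lim (\<lambda>n. g_poly A B n z)"

end

theory Submission
  imports Defs
begin

text \<open>
  With \<open>T = z\<^sup>2\<close> the recursions read \<open>c\<^sub>n\<^sub>+\<^sub>1 = T c\<^sub>n + g\<^sub>n + E\<^sub>n\<close>, \<open>g\<^sub>n\<^sub>+\<^sub>1 = g\<^sub>n + F\<^sub>n\<close> with errors at most
  \<open>e\<^sub>n (\<parallel>c\<^sub>n\<parallel> + \<parallel>g\<^sub>n\<parallel>)\<close>, where \<open>e\<close> is summable and does not depend on \<open>z\<close>. For \<open>\<bar>z\<^sup>2\<bar> \<le> q < 1\<close> the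
  quantity \<open>max \<parallel>g\<^sub>n\<parallel> ((1 - q) \<parallel>c\<^sub>n\<parallel>)\<close> grows at most by the factor \<open>1 + 2 e\<^sub>n / (1 - q)\<close>, so both
  sequences are bounded, \<open>g\<^sub>n\<close> converges uniformly, and the contraction \<open>T\<close> forces \<open>c\<^sub>n\<close> to the fixed
  point \<open>h = T h + g\<^sub>\<infinity>\<close>. Summability of \<open>\<parallel>A\<^sub>n\<^sup>-\<^sup>1 - 1\<parallel>\<close> comes from \<open>1 - A\<^sup>2 = (1 + A) (1 - A)\<close>, because
  \<open>\<parallel>(1 + A) v\<parallel> \<ge> \<parallel>v\<parallel>\<close> for positive \<open>A\<close>.
\<close>

section \<open>Perturbed contractions in normed spaces, uniformly in a parameter\<close>

text \<open>Once \<open>\<eta>\<close> is uniformly small, iterating \<open>step\<close> leaves a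
  geometric series in \<open>q\<close> plus a decaying multiple of the starting value. The bound
  \<open>D\<close> makes the decay time independent of \<open>z\<close>.\<close>

lemma uniform_limit_zero_contraction:
  fixes d \<eta> :: "nat \<Rightarrow> 'z \<Rightarrow> real"
  assumes q: "0 \<le> q" "q < 1"
    and step: "\<And>n z. z \<in> K \<Longrightarrow> d (Suc n) z \<le> q * d n z + \<eta> n z"
    and nonneg: "\<And>n z. z \<in> K \<Longrightarrow> 0 \<le> d n z"
    and bound: "\<And>n z. z \<in> K \<Longrightarrow> d n z \<le> D"
    and \<eta>: "uniform_limit K \<eta> (\<lambda>_. 0) sequentially"
  shows "uniform_limit K d (\<lambda>_. 0) sequentially"
proof (rule uniform_limitI)
  fix \<epsilon> :: real
  assume "0 < \<epsilon>"
  \<comment> \<open>Chosen so that \<open>\<epsilon> / 2\<close> is the fixed point of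
    \<open>t \<mapsto> q * t + \<delta>\<close>; this closes the induction in
    \<open>geom\<close>.\<close>
  define \<delta> where "\<delta> = \<epsilon> / 2 * (1 - q)"
  have "\<delta> > 0"
    using \<open>0 < \<epsilon>\<close> q by (simp add: \<delta>_def)
  from uniform_limitD[OF \<eta> this] obtain N
    where N: "\<And>n z. n \<ge> N \<Longrightarrow> z \<in> K \<Longrightarrow> \<bar>\<eta> n z\<bar> < \<delta>"
    by (auto simp: eventually_sequentially)
  have geom: "d (N + k) z \<le> q ^ k * D + \<epsilon> / 2" if "z \<in> K" for k z
  proof (induction k)
    case 0
    show ?case
      using bound[OF that, of N] \<open>0 < \<epsilon>\<close> by simp
  next
    case (Suc k)
    have "d (N + Suc k) z \<le> q * d (N + k) z + \<delta>"
      using step[OF that, of "N + k"] N[OF _ that, of "N + k"] by simp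
    also have "\<dots> \<le> q * (q ^ k * D + \<epsilon> / 2) + \<delta>"
      using Suc q by (intro add_right_mono mult_left_mono)
    also have "\<dots> = q ^ Suc k * D + \<epsilon> / 2"
      by (simp add: \<delta>_def field_simps)
    finally show ?case .
  qed
  have "(\<lambda>k. q ^ k * D) \<longlonglongrightarrow> 0"
    using LIMSEQ_realpow_zero[OF q] by (auto intro: tendsto_mult_left_zero)
  then have "\<forall>\<^sub>F k in sequentially. q ^ k * D < \<epsilon> / 2"
    using \<open>0 < \<epsilon>\<close> by (intro order_tendstoD) auto
  then obtain k0 where k0: "\<And>k. k \<ge> k0 \<Longrightarrow> q ^ k * D < \<epsilon> / 2"
    by (auto simp: eventually_sequentially)
  show "\<forall>\<^sub>F n in sequentially. \<forall>z\<in>K. dist (d n z) 0 < \<epsilon>"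
    unfolding eventually_sequentially
  proof (intro exI allI impI ballI)
    fix n z
    assume "N + k0 \<le> n" "z \<in> K"
    then have "q ^ (n - N) * D < \<epsilon> / 2" "d n z \<le> q ^ (n - N) * D + \<epsilon> / 2"
      using geom[of z "n - N"] k0[of "n - N"] by auto
    then have "d n z < \<epsilon>"
      by linarith
    then show "dist (d n z) 0 < \<epsilon>"
      using nonneg[OF \<open>z \<in> K\<close>] by simp
  qed
qed

text \<open>A discrete Gronwall argument. The map \<open>T\<close> enters the bounds only through
  \<open>q\<close>, so they are uniform over a family of maps sharing \<open>q\<close>,
  \<open>e\<close> and \<open>M\<close>.\<close>

lemma perturbed_contraction_bounded:
  fixes c g :: "nat \<Rightarrow> 'a::real_normed_vector" and T :: "'a \<Rightarrow> 'a"
  assumes q: "0 \<le> q" "q < 1"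
    and T: "\<And>x. norm (T x) \<le> q * norm x"
    and e: "summable e" "\<And>n. 0 \<le> e n"
    and c_step: "\<And>n. norm (c (Suc n) - T (c n) - g n) \<le> e n * (norm (c n) + norm (g n))"
    and g_step: "\<And>n. norm (g (Suc n) - g n) \<le> e n * (norm (c n) + norm (g n))"
    and init: "norm (c 0) \<le> M" "norm (g 0) \<le> M"
  shows "norm (c n) \<le> M * exp (2 / (1 - q) * suminf e) / (1 - q)"
    and "norm (g n) \<le> M * exp (2 / (1 - q) * suminf e)"
proof -
  \<comment> \<open>Majorizes \<open>M\<close> times the product of the factors
    \<open>1 + 2 / (1 - q) * e i\<close> with \<open>i < n\<close>, through
    \<open>1 + x \<le> exp x\<close>.\<close>
  define Q where "Q n = M * exp (2 / (1 - q) * sum e {..<n})" for n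
  have M: "0 \<le> M"
    using init(1) norm_ge_zero order_trans by blast
  have *: "norm (g n) \<le> Q n \<and> (1 - q) * norm (c n) \<le> Q n" for n
  proof (induction n)
    case 0
    have "(1 - q) * norm (c 0) \<le> 1 * norm (c 0)"
      using q by (intro mult_right_mono) auto
    then show ?case
      using init by (simp add: Q_def)
  next
    case (Suc n)
    define s where "s = norm (c n) + norm (g n)"
    have Q0: "0 \<le> Q n"
      using M by (simp add: Q_def)
    have s: "(1 - q) * s \<le> 2 * Q n"
    proof -
      have "(1 - q) * norm (g n) \<le> 1 * norm (g n)"
        using q by (intro mult_right_mono) auto
      then show ?thesis
        using Suc by (simp add: s_def distrib_left)
    qed
    have s0: "0 \<le> e n * s"
      using e(2) by (simp add: s_def)
    have es: "(1 - q) * (e n * s) \<le> e n * (2 * Q n)"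
      using mult_left_mono[OF s e(2)[of n]] by (simp add: mult.left_commute)
    then have es': "e n * s \<le> 2 / (1 - q) * e n * Q n"
      using q by (simp add: field_simps)
    have grow: "Q n + 2 / (1 - q) * e n * Q n \<le> Q (Suc n)"
    proof -
      have "Q n * (1 + 2 / (1 - q) * e n) \<le> Q n * exp (2 / (1 - q) * e n)"
        using Q0 by (intro mult_left_mono exp_ge_add_one_self)
      moreover have "Q (Suc n) = Q n * exp (2 / (1 - q) * e n)"
        by (simp only: Q_def sum.lessThan_Suc distrib_left exp_add mult.assoc)
      ultimately show ?thesis
        by (simp add: algebra_simps)
    qed
    have "norm (g (Suc n)) \<le> norm (g n) + norm (g (Suc n) - g n)"
      by (rule norm_triangle_sub)
    also have "\<dots> \<le> Q n + 2 / (1 - q) * e n * Q n"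
      using Suc g_step[of n] es' by (simp add: s_def)
    finally have g: "norm (g (Suc n)) \<le> Q (Suc n)"
      using grow by linarith
    have "norm (c (Suc n)) \<le> norm (T (c n) + g n) + norm (c (Suc n) - (T (c n) + g n))"
      by (rule norm_triangle_sub)
    also have "\<dots> \<le> q * norm (c n) + norm (g n) + e n * s"
      using norm_triangle_ineq[of "T (c n)" "g n"] T[of "c n"] c_step[of n]
      by (simp add: s_def diff_diff_eq)
    finally have "(1 - q) * norm (c (Suc n)) \<le> (1 - q) * (q * norm (c n) + norm (g n) + e n * s)"
      using q by (intro mult_left_mono) auto
    also have "\<dots> = q * ((1 - q) * norm (c n)) + (1 - q) * norm (g n) + (1 - q) * (e n * s)"
      by (simp add: algebra_simps)
    \<comment> \<open>The weight \<open>1 - q\<close> on \<open>norm (c n)\<close> pays off here: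
      the two induction bounds recombine with weights \<open>q\<close> and \<open>1 - q\<close> into
      exactly \<open>Q n\<close>.\<close>
    also have "\<dots> \<le> q * Q n + (1 - q) * Q n + 1 * (e n * s)"
      using Suc q s0 by (intro add_mono mult_left_mono mult_right_mono) auto
    also have "\<dots> \<le> Q n + 2 / (1 - q) * e n * Q n"
      using es' by (simp add: algebra_simps)
    finally show ?case
      using g grow by linarith
  qed
  have Q_le: "Q n \<le> M * exp (2 / (1 - q) * suminf e)"
    using M q sum_le_suminf[OF e(1), of "{..<n}"] e(2)
    by (auto simp: Q_def intro!: mult_left_mono divide_right_mono)
  show "norm (g n) \<le> M * exp (2 / (1 - q) * suminf e)"
    using *[of n] Q_le by linarith
  have "(1 - q) * norm (c n) \<le> M * exp (2 / (1 - q) * suminf e)"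
    using *[of n] Q_le by linarith
  then show "norm (c n) \<le> M * exp (2 / (1 - q) * suminf e) / (1 - q)"
    using q by (simp add: field_simps)
qed

text \<open>The increments of \<open>g\<close> have a summable majorant free of \<open>z\<close>, so
  \<open>g\<close> converges uniformly. Subtracting the fixed point equation of \<open>h\<close>
  then makes \<open>norm (c n z - h z)\<close> a contraction with vanishing perturbation.\<close>

lemma uniform_limit_perturbed_contraction:
  fixes c g :: "nat \<Rightarrow> 'z \<Rightarrow> 'a::banach" and T :: "'z \<Rightarrow> 'a \<Rightarrow> 'a"
  assumes q: "0 \<le> q" "q < 1"
    and T: "\<And>z x. z \<in> K \<Longrightarrow> norm (T z x) \<le> q * norm x"
    and T_diff: "\<And>z x y. T z (x - y) = T z x - T z y"
    and e: "summable e" "\<And>n. 0 \<le> e n"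
    and c_step: "\<And>n z. z \<in> K \<Longrightarrow>
      norm (c (Suc n) z - T z (c n z) - g n z) \<le> e n * (norm (c n z) + norm (g n z))"
    and g_step: "\<And>n z. z \<in> K \<Longrightarrow>
      norm (g (Suc n) z - g n z) \<le> e n * (norm (c n z) + norm (g n z))"
    and init: "\<And>z. z \<in> K \<Longrightarrow> norm (c 0 z) \<le> M" "\<And>z. z \<in> K \<Longrightarrow> norm (g 0 z) \<le> M"
    and h: "\<And>z. z \<in> K \<Longrightarrow> h z = T z (h z) + lim (\<lambda>n. g n z)"
  shows "uniform_limit K c h sequentially"
proof -
  define G where "G z = lim (\<lambda>n. g n z)" for z
  define X where "X = M * exp (2 / (1 - q) * suminf e)"
  have c_le: "norm (c n z) \<le> X / (1 - q)" and g_le: "norm (g n z) \<le> X" if "z \<in> K" for n z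
    using perturbed_contraction_bounded[of q "T z" e "\<lambda>n. c n z" "\<lambda>n. g n z" M n,
        OF q T[OF that] e c_step[OF that] g_step[OF that] init(1)[OF that] init(2)[OF that]]
    by (simp_all add: X_def)
  define Y where "Y = X / (1 - q) + X"
  have err: "e n * (norm (c n z) + norm (g n z)) \<le> e n * Y" if "z \<in> K" for n z
    using c_le[OF that] g_le[OF that] e(2) by (auto simp: Y_def intro!: mult_left_mono add_mono)
  have eY: "summable (\<lambda>n. e n * Y)"
    using e(1) by (rule summable_mult2)

  have "uniform_limit K (\<lambda>n z. \<Sum>i<n. g (Suc i) z - g i z) (\<lambda>z. \<Sum>i. g (Suc i) z - g i z) sequentially"
    using order_trans[OF g_step err] eY by (intro Weierstrass_m_test) auto
  then have "uniform_limit K (\<lambda>n z. g n z - g 0 z) (\<lambda>z. \<Sum>i. g (Suc i) z - g i z) sequentially"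
    by (simp add: sum_lessThan_telescope[of "\<lambda>n. g n z" for z])
  from uniform_limit_add[OF this uniform_limit_const[of "g 0" K]]
  have lim_g: "uniform_limit K g (\<lambda>z. (\<Sum>i. g (Suc i) z - g i z) + g 0 z) sequentially"
    by simp
  \<comment> \<open>The pointwise \<open>lim\<close> behind \<open>G\<close> is known to be a
    genuine limit only on \<open>K\<close>, so the two expressions are identified there.\<close>
  have G_eq: "(\<Sum>i. g (Suc i) z - g i z) + g 0 z = G z" if "z \<in> K" for z
    unfolding G_def using tendsto_uniform_limitI[OF lim_g that] by (simp add: limI)
  have lim_G: "uniform_limit K g G sequentially"
    using lim_g by (simp add: uniform_limit_iff G_eq cong: ball_cong)
  have G_le: "norm (G z) \<le> X" if "z \<in> K" for z
    using tendsto_uniform_limitI[OF lim_G that] g_le[OF that]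
    by (intro Lim_norm_ubound[where f = "\<lambda>n. g n z"]) auto
  \<comment> \<open>Absorbing \<open>T z (h z)\<close> into the left side bounds \<open>h\<close>;
    together with \<open>c_le\<close> this gives the constant \<open>D\<close> for the contraction
    lemma.\<close>
  have h_le: "norm (h z) \<le> X / (1 - q)" if "z \<in> K" for z
  proof -
    have "norm (h z) \<le> norm (T z (h z)) + norm (G z)"
      using norm_triangle_ineq[of "T z (h z)" "G z"] h[OF that] by (simp add: G_def)
    then have "(1 - q) * norm (h z) \<le> X"
      using T[OF that, of "h z"] G_le[OF that] by (simp add: algebra_simps)
    then show ?thesis
      using q by (simp add: field_simps)
  qed

  define \<eta> where "\<eta> n z = norm (g n z - G z) + e n * Y" for n z
  have "uniform_limit K (\<lambda>n z. g n z - G z) (\<lambda>z. 0) sequentially"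
    using uniform_limit_minus[OF lim_G uniform_limit_const[of G K]] by simp
  then have "uniform_limit K (\<lambda>n z. norm (g n z - G z)) (\<lambda>z. 0) sequentially"
    using uniform_limit_norm by fastforce
  moreover have "uniform_limit K (\<lambda>n z. e n * Y) (\<lambda>z. 0) sequentially"
    using summable_LIMSEQ_zero[OF eY] by (simp add: uniform_limit_iff tendsto_iff eventually_mono)
  ultimately have "uniform_limit K (\<lambda>n z. norm (g n z - G z) + e n * Y) (\<lambda>z. 0 + 0) sequentially"
    by (rule uniform_limit_add)
  then have \<eta>: "uniform_limit K \<eta> (\<lambda>_. 0) sequentially"
    by (simp add: \<eta>_def[abs_def])
  have "uniform_limit K (\<lambda>n z. norm (c n z - h z)) (\<lambda>_. 0) sequentially"
  proof (rule uniform_limit_zero_contraction[OF q _ _ _ \<eta>, where D = "X / (1 - q) + X / (1 - q)"])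
    fix n z
    assume z: "z \<in> K"
    have "c (Suc n) z - h z = T z (c n z - h z) + (g n z - G z) + (c (Suc n) z - T z (c n z) - g n z)"
      using h[OF z] by (simp add: T_diff G_def algebra_simps)
    also have "norm \<dots> \<le> norm (T z (c n z - h z)) + norm (g n z - G z)
        + norm (c (Suc n) z - T z (c n z) - g n z)"
      by (intro norm_triangle_mono order_refl)
    also have "\<dots> \<le> q * norm (c n z - h z) + \<eta> n z"
      using T[OF z, of "c n z - h z"] order_trans[OF c_step[OF z] err[OF z], of n]
      by (simp add: \<eta>_def)
    finally show "norm (c (Suc n) z - h z) \<le> q * norm (c n z - h z) + \<eta> n z" .
    show "norm (c n z - h z) \<le> X / (1 - q) + X / (1 - q)"
      using norm_triangle_ineq4[of "c n z" "h z"] c_le[OF z, of n] h_le[OF z] by linarith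
  qed simp
  then show ?thesis
    by (simp add: uniform_limit_iff dist_norm)
qed

section \<open>Entrywise Euclidean norm versus operator norm of matrices\<close>

lemma norm_cscale: "norm (z *\<^sub>c X) = cmod z * norm X"
  for X :: "complex ^ 'n::finite ^ 'm::finite"
  by (simp add: cscale_def norm_vec_def norm_mult L2_set_right_distrib)

lemma norm_matrix_le_sum: "norm X \<le> (\<Sum>i\<in>UNIV. \<Sum>j\<in>UNIV. cmod (X $ i $ j))"
  for X :: "complex ^ 'n::finite ^ 'm::finite"
proof -
  have "norm X \<le> (\<Sum>i\<in>UNIV. norm (X $ i))"
    unfolding norm_vec_def[of X] by (rule L2_set_le_sum) simp
  also have "\<dots> \<le> (\<Sum>i\<in>UNIV. \<Sum>j\<in>UNIV. cmod (X $ i $ j))"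
    by (intro sum_mono) (simp add: norm_vec_def L2_set_le_sum)
  finally show ?thesis .
qed

text \<open>Each entry of the product is a sum of \<open>CARD('l)\<close> terms and there are
  \<open>CARD('l) ^ 2\<close> entries. Only the finiteness of the constant matters later.\<close>

lemma norm_matrix_mult_le: "norm (X ** Y) \<le> real CARD('l) ^ 3 * norm X * norm Y"
  for X Y :: "complex ^ 'l::finite ^ 'l"
proof -
  have nth: "cmod (Z $ i $ j) \<le> norm Z" for Z :: "complex ^ 'l ^ 'l" and i j
    using Finite_Cartesian_Product.norm_nth_le[of "Z $ i" j] Finite_Cartesian_Product.norm_nth_le[of Z i] by linarith
  have "cmod ((X ** Y) $ i $ j) \<le> real CARD('l) * (norm X * norm Y)" for i j
  proof -
    have "cmod ((X ** Y) $ i $ j) \<le> (\<Sum>k\<in>UNIV. cmod (X $ i $ k * Y $ k $ j))"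
      by (simp add: matrix_matrix_mult_def norm_sum)
    also have "\<dots> \<le> (\<Sum>k\<in>(UNIV :: 'l set). norm X * norm Y)"
      by (intro sum_mono) (simp add: norm_mult mult_mono nth)
    finally show ?thesis by simp
  qed
  then have "norm (X ** Y) \<le> (\<Sum>i\<in>(UNIV :: 'l set). \<Sum>j\<in>(UNIV :: 'l set). real CARD('l) * (norm X * norm Y))"
    by (intro order_trans[OF norm_matrix_le_sum] sum_mono)
  then show ?thesis
    by (simp add: power3_eq_cube mult.assoc)
qed

lemma norm_matrix_vector_le_opnorm: "norm (X *v v) \<le> opnorm X * norm v"
  for X :: "complex ^ 'n::finite ^ 'm::finite"
  unfolding opnorm_def by (rule onorm) (rule matrix_vector_mul_bounded_linear)

text \<open>Testing on the unit vectors \<open>axis j 1\<close> bounds every entry by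
  \<open>b\<close>.\<close>

lemma norm_le_if_matrix_vector_le:
  fixes X :: "complex ^ 'l::finite ^ 'l"
  assumes "\<And>v. norm (X *v v) \<le> b * norm v"
  shows "norm X \<le> real CARD('l) ^ 2 * b"
proof -
  have "cmod (X $ i $ j) \<le> b" for i j
  proof -
    have "X $ i $ j = (X *v axis j 1) $ i"
      by (simp add: matrix_vector_mult_def axis_def if_distrib[where f = "(*) _"] cong: if_cong)
    also have "cmod \<dots> \<le> norm (X *v axis j 1)"
      by (rule Finite_Cartesian_Product.norm_nth_le)
    also have "\<dots> \<le> b"
      using assms[of "axis j 1"] by (simp add: norm_axis_1)
    finally show ?thesis .
  qed
  then have "norm X \<le> (\<Sum>i\<in>(UNIV :: 'l set). \<Sum>j\<in>(UNIV :: 'l set). b)"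
    by (intro order_trans[OF norm_matrix_le_sum] sum_mono)
  then show ?thesis
    by (simp add: power2_eq_square mult.assoc)
qed

lemma norm_le_opnorm: "norm X \<le> real CARD('l) ^ 2 * opnorm X"
  for X :: "complex ^ 'l::finite ^ 'l"
  by (intro norm_le_if_matrix_vector_le norm_matrix_vector_le_opnorm)

lemma opnorm_nonneg: "0 \<le> opnorm X"
  for X :: "complex ^ 'n::finite ^ 'm::finite"
  unfolding opnorm_def by (rule onorm_pos_le) (rule matrix_vector_mul_bounded_linear)

section \<open>Positive definite blocks close to the identity\<close>

text \<open>The real inner product \<open>v \<bullet> (X *v v)\<close> is the real part of the
  Hermitian form, so the cross term in the squared norm of \<open>v + X *v v\<close> is
  nonnegative.\<close>

lemma pos_def_norm_add_ge:
  fixes X :: "complex ^ 'l::finite ^ 'l"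
  assumes "pos_def X"
  shows "norm v \<le> norm (v + X *v v)"
proof -
  have "0 \<le> v \<bullet> (X *v v)"
  proof (cases "v = 0")
    case False
    have "v \<bullet> (X *v v) = Re (\<Sum>i\<in>UNIV. cnj (v $ i) * (X *v v) $ i)"
      by (simp add: inner_vec_def inner_complex_def)
    then show ?thesis
      using assms False by (auto simp: pos_def_def less_imp_le)
  qed simp
  then show ?thesis
    by (simp add: norm_le inner_add_left inner_add_right inner_commute)
qed

lemma pos_def_norm_diff_le:
  fixes X :: "complex ^ 'l::finite ^ 'l"
  assumes "pos_def X"
  shows "norm (v - X *v v) \<le> opnorm (mat 1 - X ** adj X) * norm v"
proof -
  have adj: "adj X = X"
    using assms by (simp add: pos_def_def hermitian_def)
  have "norm (v - X *v v) \<le> norm ((v - X *v v) + X *v (v - X *v v))"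
    by (rule pos_def_norm_add_ge[OF assms])
  also have "(v - X *v v) + X *v (v - X *v v) = (mat 1 - X ** adj X) *v v"
    by (simp add: adj matrix_vector_mult_diff_distrib matrix_vector_mult_diff_rdistrib
        matrix_vector_mul_assoc)
  also have "norm \<dots> \<le> opnorm (mat 1 - X ** adj X) * norm v"
    by (rule norm_matrix_vector_le_opnorm)
  finally show ?thesis .
qed

text \<open>With \<open>w\<close> the image of \<open>v\<close> under the inverse,
  \<open>w - v = w - X *v w\<close>, so the estimate for \<open>1 - X\<close> applies at
  \<open>w\<close>; smallness then bounds \<open>w\<close> by \<open>2 * norm v\<close>.\<close>

lemma norm_matrix_inv_diff_le:
  fixes X :: "complex ^ 'l::finite ^ 'l"
  assumes "pos_def X" "invertible X" and small: "opnorm (mat 1 - X ** adj X) \<le> 1 / 2"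
  shows "norm (matrix_inv X - mat 1) \<le> real CARD('l) ^ 2 * (2 * opnorm (mat 1 - X ** adj X))"
proof (rule norm_le_if_matrix_vector_le)
  fix v :: "complex ^ 'l"
  let ?\<delta> = "opnorm (mat 1 - X ** adj X)"
  define w where "w = matrix_inv X *v v"
  have Xw: "X *v w = v"
    using matrix_inv_cancel(1)[OF assms(2), of "mat 1"] by (simp add: w_def matrix_vector_mul_assoc)
  have wv: "norm (w - v) \<le> ?\<delta> * norm w"
    using pos_def_norm_diff_le[OF assms(1), of w] by (simp add: Xw)
  also have "\<dots> \<le> 1 / 2 * norm w"
    using small by (intro mult_right_mono) auto
  finally have "norm w \<le> 2 * norm v"
    using norm_triangle_sub[of w v] by simp
  then have "?\<delta> * norm w \<le> ?\<delta> * (2 * norm v)"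
    by (intro mult_left_mono opnorm_nonneg)
  with wv show "norm ((matrix_inv X - mat 1) *v v) \<le> 2 * ?\<delta> * norm v"
    by (simp add: matrix_vector_mult_diff_rdistrib w_def)
qed

section \<open>Convergence of \<open>c_poly\<close> on compact subsets of the open disk\<close>

theorem theorem4p4:
  fixes A B :: "nat \<Rightarrow> complex ^ 'l::finite ^ 'l" and K :: "complex set"
  assumes "block_jacobi A B" and "type1 A"
    and "summable (\<lambda>n. opnorm (B (Suc n)) + opnorm (mat 1 - A (Suc n) ** adj (A (Suc n))))"
    and "compact K" and "K \<subseteq> ball 0 1"
  shows "uniform_limit K (\<lambda>n z. c_poly A B n z) (\<lambda>z. (1 / (1 - z\<^sup>2)) *\<^sub>c g_inf A B z) sequentially"
proof -
  note J = \<open>block_jacobi A B\<close>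
  define S where "S n = opnorm (B (Suc n)) + opnorm (mat 1 - A (Suc n) ** adj (A (Suc n)))" for n
  define D where "D n = mat 1 - A (Suc n) ** adj (A (Suc n))" for n
  define R where "R n = matrix_inv (A (Suc n)) - mat 1" for n
  define \<gamma> where "\<gamma> = real CARD('l) ^ 3"
  define \<beta> where "\<beta> n = norm (B (Suc n)) + norm (D n)" for n
  \<comment> \<open>The coefficient delivered by \<open>step\<close> below: the first summand
    controls \<open>R n ** (P + V ** c)\<close>, the second \<open>V ** c\<close>.\<close>
  define e where "e n = \<gamma> * norm (R n) * (1 + \<gamma> * \<beta> n) + \<gamma> * \<beta> n" for n
  have S: "summable S"
    using assms(3) by (simp add: S_def[abs_def])
  have \<gamma>: "0 \<le> \<gamma>"
    by (simp add: \<gamma>_def)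
  note mult_le = norm_matrix_mult_le[where 'l = 'l, folded \<gamma>_def]

  have sum_\<beta>: "summable \<beta>"
  proof (rule summable_comparison_test')
    show "summable (\<lambda>n. real CARD('l) ^ 2 * S n)"
      using S by (rule summable_mult)
    show "norm (\<beta> n) \<le> real CARD('l) ^ 2 * S n" for n
      using norm_le_opnorm[of "B (Suc n)"] norm_le_opnorm[of "D n"]
      by (simp add: \<beta>_def S_def D_def distrib_left)
  qed
  have sum_R: "summable (\<lambda>n. norm (R n))"
  proof -
    \<comment> \<open>The inverse estimate needs its smallness hypothesis, which holds for all large
      \<open>n\<close>; finitely many terms do not affect summability.\<close>
    have "\<forall>\<^sub>F n in sequentially. S n < 1 / 2"
      using summable_LIMSEQ_zero[OF S] by (rule order_tendstoD) simp
    then have "\<forall>\<^sub>F n in sequentially. norm (norm (R n)) \<le> real CARD('l) ^ 2 * (2 * S n)"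
    proof eventually_elim
      case (elim n)
      have le: "opnorm (mat 1 - A (Suc n) ** adj (A (Suc n))) \<le> S n"
        by (simp add: S_def opnorm_nonneg)
      have "norm (R n) \<le> real CARD('l) ^ 2 * (2 * opnorm (mat 1 - A (Suc n) ** adj (A (Suc n))))"
        unfolding R_def using assms(1,2) elim le
        by (intro norm_matrix_inv_diff_le) (auto simp: type1_def block_jacobi_def)
      also have "\<dots> \<le> real CARD('l) ^ 2 * (2 * S n)"
        using le by (intro mult_left_mono) auto
      finally show ?case by simp
    qed
    then show ?thesis
      by (rule summable_comparison_test_ev) (intro summable_mult S)
  qed
  have sum_e: "summable e"
  proof -
    have "summable (\<lambda>n. norm (R n) * \<beta> n)"
    proof (rule summable_comparison_test_ev)
      have "\<forall>\<^sub>F n in sequentially. \<beta> n < 1"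
        using summable_LIMSEQ_zero[OF sum_\<beta>] by (rule order_tendstoD) simp
      then show "\<forall>\<^sub>F n in sequentially. norm (norm (R n) * \<beta> n) \<le> norm (R n)"
        by eventually_elim (auto simp: \<beta>_def norm_mult intro!: mult_left_le)
      show "summable (\<lambda>n. norm (R n))"
        by (rule sum_R)
    qed
    then have "summable (\<lambda>n. \<gamma> * norm (R n) + \<gamma> * \<gamma> * (norm (R n) * \<beta> n) + \<gamma> * \<beta> n)"
      using sum_R sum_\<beta> by (intro summable_add summable_mult)
    then show ?thesis
      by (simp add: e_def[abs_def] algebra_simps)
  qed

  \<comment> \<open>Compactness keeps \<open>K\<close> at positive distance from the unit circle;
    the empty set has no point of maximal modulus and is treated apart.\<close>
  obtain r where r: "0 \<le> r" "r < 1" "\<And>z. z \<in> K \<Longrightarrow> cmod z \<le> r"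
  proof (cases "K = {}")
    case True
    then show ?thesis
      using that[of 0] by simp
  next
    case False
    then obtain w where "w \<in> K" "\<And>z. z \<in> K \<Longrightarrow> cmod z \<le> cmod w"
      using continuous_attains_sup[OF \<open>compact K\<close>, of cmod] by (auto intro: continuous_intros)
    then show ?thesis
      using that[of "cmod w"] \<open>K \<subseteq> ball 0 1\<close> by auto
  qed
  define q where "q = r\<^sup>2"
  have q: "0 \<le> q" "q < 1"
    using r(1,2) by (simp_all add: q_def power_less_one_iff)

  \<comment> \<open>One estimate serves both recursions: \<open>P\<close> is the unperturbed
    right-hand side, \<open>V\<close> the perturbing coefficient, and inverting
    \<open>A (Suc n)\<close> costs the further error \<open>R n\<close>.\<close>
  have step: "norm (X - P) \<le> e n * s"
    if AX: "A (Suc n) ** X = P + V ** c"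
      and P: "norm P \<le> s" and V: "norm V \<le> \<beta> n" and c: "norm c \<le> s"
    for n s and X P V c :: "complex ^ 'l ^ 'l"
  proof -
    have "invertible (A (Suc n))"
      using J by (simp add: block_jacobi_def)
    then have "X = matrix_inv (A (Suc n)) ** (P + V ** c)"
      using matrix_inv_cancel(2)[of "A (Suc n)" X] AX by simp
    then have "X - P = R n ** (P + V ** c) + V ** c"
      by (simp add: R_def matrix_diff_rdistrib)
    also have "norm \<dots> \<le> \<gamma> * norm (R n) * norm (P + V ** c) + norm (V ** c)"
      by (intro norm_triangle_mono mult_le order_refl)
    finally have XP: "norm (X - P) \<le> \<gamma> * norm (R n) * norm (P + V ** c) + norm (V ** c)" .
    have "norm (V ** c) \<le> \<gamma> * norm V * norm c"
      by (rule mult_le)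
    also have "\<dots> \<le> \<gamma> * \<beta> n * s"
      using V c \<gamma> by (intro mult_mono) (auto simp: \<beta>_def)
    finally have Vc: "norm (V ** c) \<le> \<gamma> * \<beta> n * s" .
    then have "norm (P + V ** c) \<le> s + \<gamma> * \<beta> n * s"
      using P by (rule norm_triangle_mono[rotated])
    then have "\<gamma> * norm (R n) * norm (P + V ** c) \<le> \<gamma> * norm (R n) * (s + \<gamma> * \<beta> n * s)"
      using \<gamma> by (intro mult_left_mono) auto
    with XP Vc show ?thesis
      by (simp add: e_def algebra_simps)
  qed

  show ?thesis
  proof (rule uniform_limit_perturbed_contraction
      [where T = "\<lambda>z X. z\<^sup>2 *\<^sub>c X" and g = "\<lambda>n z. g_poly A B n z" and M = "norm (mat 1 :: complex ^ 'l ^ 'l)",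
        OF q _ _ sum_e])
    fix z :: complex and X Y :: "complex ^ 'l ^ 'l"
    show "z\<^sup>2 *\<^sub>c (X - Y) = z\<^sup>2 *\<^sub>c X - z\<^sup>2 *\<^sub>c Y"
      by (rule cscale_diff)
  next
    fix n
    show "0 \<le> e n"
      using \<gamma> by (auto simp: e_def \<beta>_def)
  next
    fix z
    assume z: "z \<in> K"
    have z_sq: "cmod (z\<^sup>2) \<le> q"
      using r(3)[OF z] by (simp add: q_def norm_power power_mono)
    show "norm (z\<^sup>2 *\<^sub>c X) \<le> q * norm X" for X :: "complex ^ 'l ^ 'l"
      unfolding norm_cscale using z_sq by (rule mult_right_mono) simp
    have small: "norm (u *\<^sub>c X) \<le> norm X" if "cmod u \<le> 1" for u and X :: "complex ^ 'l ^ 'l"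
      using that by (simp add: norm_cscale mult_left_le_one_le)
    have z1: "cmod z \<le> 1" "cmod (z\<^sup>2) \<le> 1"
      using r(2) r(3)[OF z] z_sq q by auto
    show "norm (c_poly A B 0 z) \<le> norm (mat 1 :: complex ^ 'l ^ 'l)"
      and "norm (g_poly A B 0 z) \<le> norm (mat 1 :: complex ^ 'l ^ 'l)"
      by (simp_all add: c_poly_0[OF J] g_poly_0[OF J])
    {
      fix n
      define c where "c = c_poly A B n z"
      define g where "g = g_poly A B n z"
      have "norm (c_poly A B (Suc n) z - (z\<^sup>2 *\<^sub>c c + g)) \<le> e n * (norm c + norm g)"
      proof (rule step)
        show "A (Suc n) ** c_poly A B (Suc n) z = z\<^sup>2 *\<^sub>c c + g + (- (z *\<^sub>c B (Suc n))) ** c"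
          using c_poly_Suc[OF J, of n z] matrix_diff_rdistrib[of 0 "z *\<^sub>c B (Suc n)" c]
          by (simp add: c_def g_def matrix_diff_rdistrib cscale_mult_left)
        show "norm (z\<^sup>2 *\<^sub>c c + g) \<le> norm c + norm g"
          using z1 by (intro norm_triangle_mono small order_refl)
        show "norm (- (z *\<^sub>c B (Suc n))) \<le> \<beta> n"
          using small[OF z1(1), of "B (Suc n)"] by (simp add: \<beta>_def add_increasing2)
      qed simp
      then show "norm (c_poly A B (Suc n) z - z\<^sup>2 *\<^sub>c c_poly A B n z - g_poly A B n z)
          \<le> e n * (norm (c_poly A B n z) + norm (g_poly A B n z))"
        by (simp add: c_def g_def diff_diff_eq)
      have "norm (g_poly A B (Suc n) z - g) \<le> e n * (norm c + norm g)"
      proof (rule step)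
        show "A (Suc n) ** g_poly A B (Suc n) z = g + (z\<^sup>2 *\<^sub>c D n - z *\<^sub>c B (Suc n)) ** c"
          using g_poly_Suc[OF J, of n z] by (simp add: c_def g_def D_def)
        show "norm (z\<^sup>2 *\<^sub>c D n - z *\<^sub>c B (Suc n)) \<le> \<beta> n"
          using norm_triangle_ineq4[of "z\<^sup>2 *\<^sub>c D n" "z *\<^sub>c B (Suc n)"]
            small[OF z1(1), of "B (Suc n)"] small[OF z1(2), of "D n"]
          by (simp add: \<beta>_def)
      qed simp_all
      then show "norm (g_poly A B (Suc n) z - g_poly A B n z)
          \<le> e n * (norm (c_poly A B n z) + norm (g_poly A B n z))"
        by (simp add: c_def g_def)
    }
    \<comment> \<open>Entrywise, \<open>x / w\<close> solves \<open>y = u * y + x\<close> when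
      \<open>w = 1 - u\<close>; with \<open>u = z\<^sup>2\<close> this identifies the limit as the
      fixed point.\<close>
    have fixed: "1 / w * x = u * (1 / w * x) + x" if "w \<noteq> 0" "u = 1 - w" for u w x :: complex
      using that(1) unfolding that(2) by (simp add: field_simps)
    have "1 - z\<^sup>2 \<noteq> 0"
      using z_sq q by auto
    then show "(1 / (1 - z\<^sup>2)) *\<^sub>c g_inf A B z
        = z\<^sup>2 *\<^sub>c (1 / (1 - z\<^sup>2)) *\<^sub>c g_inf A B z + lim (\<lambda>n. g_poly A B n z)"
      unfolding g_inf_def[symmetric] cscale_def vec_eq_iff vec_lambda_beta vector_add_component
      by (intro allI fixed) simp_all
  qed
qed

end
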